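(* Let $G$ be a group of order $v$, written additively (not necessarily abelian), and let $A=\{A_1,\dots,A_m\}$ be a non-disjoint $(v,m,k_1,\dots,k_m)$-GPSEDF in $G$. Then: (i) For each $1\le j\le m$, $\{A_1,\dots,A_{j-1},\overline{A_j},A_{j+1},\dots,A_m\}$ is a non-disjoint $(v,m,k_1,\dots,k_{j-1},v-k_j,k_{j+1},\dots,k_m)$-GPSEDF, where $\overline{A_j}=G\setminus A_j$. (ii) $\{\overline{A_1},\dots,\overline{A_m}\}$ is a non-disjoint $(v,m,v-k_1,\dots,v-k_m)$-GPSEDF in $G$. (iii) For every $g\in G$, $\{A_1,\dots,A_{m-1},g+A_m\}$ is a non-disjoint $(v,m,k_1,\dots,k_m)$-GPSEDF, where $g+A_m=\{g+a:a\in A_m\}$. (iv) Let $B=\{A_1,\dots,A_{m-1},B_m\}$ be a non-disjoint $(v,m,k_1,\dots,k_{m-1},l_m)$-MGPSEDF in $G$. Then $C=\{A_1,\dots,A_{m-1},A_m\uplus B_m\}$ is a non-disjoint $(v,m,k_1,\dots,k_{m-1},k_m+l_m)$-MGPSEDF. If moreover $B$ is a non-disjoint GPSEDF (i.e. $B_m$ is a set) and $A_m$ and $B_m$ are disjoint, then $C$ is a non-disjoint GPSEDF. (v) Let $g_1,\dots,g_n\in G$. Then $\{A_1,\dots,A_{m-1},\uplus_{i=1}^n(g_i+A_m)\}$ is a non-disjoint $(v,m,k_1,\dots,k_{m-1},nk_m)$-MGPSEDF; if the sets $g_i+A_m$ ($1\le i\le n$) are pairwise disjoint, it is a non-disjoint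 GPSEDF.
   Context: For finite multisets $A,B$ of elements of an additively written group $G$, $\Delta(A,B)$ denotes the multiset $\{a-b: a\in A, b\in B\}$, where $a-b=a+(-b)$ and each pair (with multiplicities) contributes one entry. $A\uplus B$ denotes multiset union, and $|A|$ is the size of a multiset counted with multiplicity. For $\lambda\in\mathbb{N}\cup\{0\}$, $\lambda G$ is the multiset containing every element of $G$ exactly $\lambda$ times. Let $|G|=v$. A family of sets $\{A_1,\dots,A_m\}$ in $G$ with $|A_i|=k_i$ is a non-disjoint $(v,m,k_1,\dots,k_m)$-GPSEDF if $\Delta(A_i,A_j)=\lambda_{i,j}G$ with $\lambda_{i,j}=k_ik_j/v$ for all $1\le i\ne j\le m$. A non-disjoint $(v,m,k_1,\dots,k_m)$-MGPSEDF is defined identically except that $A_1,\dots,A_m$ are multisets (with $|A_i|=k_i$ counted with multiplicity). *)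

theory Defs
  imports Complex_Main "HOL-Library.Multiset" "HOL-Library.Cardinality" "HOL-Library.Disjoint_Sets"
begin

definition Delta :: "'a::group_add multiset \<Rightarrow> 'a multiset \<Rightarrow> 'a multiset" where
  "Delta A B = (\<Sum>a\<in>#A. image_mset (\<lambda>b. a - b) B)"

text \<open>The multiset \<open>\<lambda>G\<close>, where the group \<open>G\<close> is the whole (finite) type.\<close>

definition mult_group :: "nat \<Rightarrow> 'a::{group_add,finite} multiset" where
  "mult_group lam = repeat_mset lam (mset_set UNIV)"

text \<open>
  A family \<open>A\<^sub>1, \<dots>, A\<^sub>m\<close> and its sizes \<open>k\<^sub>1, \<dots>, k\<^sub>m\<close> are functions on \<open>nat\<close> of which
  only the values on \<open>{1..m}\<close> matter; members of a family may coincide or be empty.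
  The division in \<open>\<lambda>\<^sub>i\<^sub>j = k\<^sub>i k\<^sub>j / v\<close> is exact division in the reals, so that \<open>v\<close> dividing
  \<open>k\<^sub>i k\<^sub>j\<close> is part of the definition.
\<close>

definition nondisjoint_MGPSEDF ::
  "nat \<Rightarrow> nat \<Rightarrow> (nat \<Rightarrow> nat) \<Rightarrow> (nat \<Rightarrow> 'a::{group_add,finite} multiset) \<Rightarrow> bool" where
  "nondisjoint_MGPSEDF v m k A \<longleftrightarrow>
     CARD('a) = v \<and>
     (\<forall>i\<in>{1..m}. size (A i) = k i) \<and>
     (\<forall>i\<in>{1..m}. \<forall>j\<in>{1..m}. i \<noteq> j \<longrightarrow>
        (\<exists>lam::nat. real lam = real (k i) * real (k j) / real v \<and>
                    Delta (A i) (A j) = mult_group lam))"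

definition nondisjoint_GPSEDF ::
  "nat \<Rightarrow> nat \<Rightarrow> (nat \<Rightarrow> nat) \<Rightarrow> (nat \<Rightarrow> 'a::{group_add,finite} set) \<Rightarrow> bool" where
  "nondisjoint_GPSEDF v m k A \<longleftrightarrow>
     CARD('a) = v \<and>
     (\<forall>i\<in>{1..m}. card (A i) = k i) \<and>
     (\<forall>i\<in>{1..m}. \<forall>j\<in>{1..m}. i \<noteq> j \<longrightarrow>
        (\<exists>lam::nat. real lam = real (k i) * real (k j) / real v \<and>
                    Delta (mset_set (A i)) (mset_set (A j)) = mult_group lam))"

definition translate :: "'a::group_add \<Rightarrow> 'a set \<Rightarrow> 'a set" where
  "translate g A = {g + a | a. a \<in> A}"

end

theory Submission
  imports Defs
begin

text \<open>
  Comparing sizes, \<open>\<Delta>(A\<^sub>i, A\<^sub>j) = \<lambda>G\<close> forces \<open>\<lambda> = k\<^sub>i k\<^sub>j / v\<close>. Hence the defining condition is only that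
  each element of \<open>G\<close> occurs equally often in \<open>\<Delta>(A\<^sub>i, A\<^sub>j)\<close>. This property is symmetric in \<open>i\<close> and \<open>j\<close>,
  because \<open>\<Delta>(B, A) = -\<Delta>(A, B)\<close>, so it suffices to follow the second argument of \<open>\<Delta>\<close>:
  it enters additively, \<open>\<Delta>(A, G)\<close> is a multiple of \<open>G\<close>, and a left translation of the second
  argument acts on \<open>\<Delta>\<close> as a right translation.
\<close>

section \<open>Multisets with constant multiplicity\<close>

definition uniform :: "'a::{group_add,finite} multiset \<Rightarrow> bool" where
  "uniform M \<longleftrightarrow> (\<exists>lam. M = mult_group lam)"

lemma count_mult_group [simp]: "count (mult_group lam) x = lam"
  by (simp add: mult_group_def)

lemma size_mult_group: "size (mult_group lam :: 'a::{group_add,finite} multiset) = lam * CARD('a)"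
  by (simp add: mult_group_def)

lemma uniform_iff: "uniform M \<longleftrightarrow> (\<exists>lam. \<forall>x. count M x = lam)"
  by (auto simp: uniform_def multiset_eq_iff)

lemma uniform_empty: "uniform {#}"
  by (simp add: uniform_iff)

lemma uniform_UNIV: "uniform (mset_set UNIV)"
  by (simp add: uniform_iff)

lemma uniform_add:
  assumes "uniform M" and "uniform N"
  shows "uniform (M + N)"
proof -
  obtain a b where "\<And>x. count M x = a" and "\<And>x. count N x = b"
    using assms unfolding uniform_iff by auto
  then show ?thesis
    by (simp add: uniform_iff)
qed

text \<open>Constant multiplicities can be subtracted pointwise; this is what makes complements
  work.\<close>

lemma uniform_add_cancel:
  assumes "uniform (M + N)" and "uniform M"
  shows "uniform N"
proof -
  obtain a b where "\<forall>x. count M x + count N x = a" and "\<forall>x. count M x = b"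
    using assms unfolding uniform_iff by auto
  then have "\<forall>x. count N x = a - b"
    by (metis add_diff_cancel_left')
  then show ?thesis
    unfolding uniform_iff by blast
qed

text \<open>A bijection merely permutes the elements of the group, so it fixes every multiple of the
  whole group.\<close>

lemma uniform_image_bij:
  assumes "uniform M" and "bij f"
  shows "uniform (image_mset f M)"
proof -
  obtain lam where M: "M = mult_group lam"
    using assms(1) unfolding uniform_def by auto
  have "image_mset f (mset_set UNIV) = mset_set UNIV"
    using assms(2) by (simp add: image_mset_mset_set bij_is_inj bij_is_surj)
  then have "image_mset f (repeat_mset n (mset_set UNIV)) = repeat_mset n (mset_set UNIV)" for n
    by (induction n) simp_all
  then show ?thesis
    unfolding M uniform_def mult_group_def by blast
qed

section \<open>Algebra of the difference multiset\<close>

lemma Delta_empty_left [simp]: "Delta {#} B = {#}"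
  by (simp add: Delta_def)

lemma Delta_add_mset_left [simp]: "Delta (add_mset a A) B = image_mset (\<lambda>b. a - b) B + Delta A B"
  by (simp add: Delta_def)

lemma Delta_empty_right [simp]: "Delta A {#} = {#}"
  by (simp add: Delta_def)

lemma Delta_add_right: "Delta A (B + C) = Delta A B + Delta A C"
  by (induction A) auto

lemma Delta_singleton_right: "Delta A {#b#} = image_mset (\<lambda>a. a - b) A"
  by (induction A) auto

lemma size_Delta: "size (Delta A B) = size A * size B"
  by (induction A) auto

text \<open>The identity b - a = -(a - b) holds in every group, abelian or not.\<close>

lemma Delta_commute: "Delta B A = image_mset uminus (Delta A B)"
proof (induction A)
  case (add a A)
  have "Delta B (add_mset a A) = Delta B {#a#} + Delta B A"
    using Delta_add_right[of B "{#a#}" A] by simp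
  with add show ?case
    by (simp add: Delta_singleton_right multiset.map_comp comp_def)
qed simp

text \<open>Since -(g + b) = -b - g, the order of the summands flips: a - (g + b) = (a - b) - g,
  without commutativity.\<close>

lemma Delta_translate_right:
  "Delta A (image_mset ((+) g) B) = image_mset (\<lambda>x. x - g) (Delta A B)"
  by (induction A)
    (auto simp: multiset.map_comp comp_def diff_add_eq_diff_diff_swap)

section \<open>Operations on one argument that keep the differences uniform\<close>

lemma uniform_Delta_commute: "uniform (Delta A B) \<longleftrightarrow> uniform (Delta B A)"
  using uniform_image_bij[OF _ bij_uminus] Delta_commute by metis

lemma uniform_Delta_add:
  "uniform (Delta A B) \<Longrightarrow> uniform (Delta A C) \<Longrightarrow> uniform (Delta A (B + C))"
  by (simp add: Delta_add_right uniform_add)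

text \<open>For fixed \<open>a\<close> the differences a - b run through the group once, so each
  entry of \<open>A\<close> contributes one full copy.\<close>

lemma uniform_Delta_UNIV: "uniform (Delta A (mset_set UNIV))"
proof (induction A)
  case (add a A)
  have "bij (\<lambda>b. a - b)"
    \<comment> \<open>Solving x = a - b for b gives b = -x + a; the order matters in a nonabelian
      group.\<close>
    by (rule bij_betw_byWitness[where f' = "\<lambda>b. - b + a"]) (auto simp: algebra_simps)
  with add show ?case
    by (simp add: uniform_add uniform_image_bij uniform_UNIV)
qed (simp add: uniform_empty)

text \<open>The differences with \<open>B\<close> and with its complement add up to those with the
  whole group, which are uniform; the known part cancels.\<close>

lemma uniform_Delta_Compl:
  assumes "uniform (Delta A (mset_set B))"
  shows "uniform (Delta A (mset_set (UNIV - B)))"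
proof -
  have "mset_set UNIV = mset_set B + mset_set (UNIV - B)"
    by (subst mset_set_Union[symmetric]) auto
  then have "uniform (Delta A (mset_set B) + Delta A (mset_set (UNIV - B)))"
    using uniform_Delta_UNIV[of A] by (simp add: Delta_add_right)
  then show ?thesis
    using assms by (rule uniform_add_cancel)
qed

lemma mset_set_translate: "mset_set (translate g A) = image_mset ((+) g) (mset_set A)"
  by (subst image_mset_mset_set) (auto simp: translate_def image_def intro: arg_cong[of _ _ mset_set])

lemma card_translate: "card (translate g A) = card A"
  by (metis mset_set_translate size_image_mset size_mset_set)

lemma uniform_Delta_translate:
  assumes "uniform (Delta A (mset_set B))"
  shows "uniform (Delta A (mset_set (translate g B)))"
proof -
  have "bij (\<lambda>x. x - g)"
    by (rule bij_betw_byWitness[where f' = "\<lambda>x. x + g"]) auto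
  with assms show ?thesis
    by (simp add: mset_set_translate Delta_translate_right uniform_image_bij)
qed

lemma uniform_Delta_sum:
  assumes "\<And>i. i \<in> I \<Longrightarrow> uniform (Delta A (B i))"
  shows "uniform (Delta A (\<Sum>i\<in>I. B i))"
  using assms
  \<comment> \<open>For infinite \<open>I\<close> the sum defaults to the empty multiset, whose
    differences are trivially uniform.\<close>
  by (induction I rule: infinite_finite_induct) (auto simp: uniform_empty uniform_Delta_add)

lemma mset_set_UN_disjoint:
  assumes "finite I" and "\<And>i. i \<in> I \<Longrightarrow> finite (A i)" and "disjoint_family_on A I"
  shows "mset_set (\<Union>i\<in>I. A i) = (\<Sum>i\<in>I. mset_set (A i))"
  using assms
proof (induction I rule: finite_induct)
  case (insert i I)
  then have "A i \<inter> (\<Union>i\<in>I. A i) = {}"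
    by (auto simp: disjoint_family_on_def)
  moreover have "disjoint_family_on A I"
    using insert.prems(2) by (auto simp: disjoint_family_on_def)
  ultimately show ?case
    using insert by (simp add: mset_set_Union)
qed simp

section \<open>The definitions in terms of uniformity, and replacement of one member\<close>

lemma nondisjoint_MGPSEDF_iff:
  fixes A :: "nat \<Rightarrow> 'a::{group_add,finite} multiset"
  shows "nondisjoint_MGPSEDF v m k A \<longleftrightarrow>
     CARD('a) = v \<and> (\<forall>i\<in>{1..m}. size (A i) = k i) \<and>
     (\<forall>i\<in>{1..m}. \<forall>j\<in>{1..m}. i \<noteq> j \<longrightarrow> uniform (Delta (A i) (A j)))"
proof -
  have "real lam = real (size (A i)) * real (size (A j)) / real CARD('a)"
    if "Delta (A i) (A j) = mult_group lam" for i j lam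
  proof -
    have "size (A i) * size (A j) = lam * CARD('a)"
      using that by (metis size_Delta size_mult_group)
    then have "real (size (A i)) * real (size (A j)) = real lam * real CARD('a)"
      by (metis of_nat_mult)
    then show ?thesis
      by simp
  qed
  then have "(\<exists>lam. real lam = real (k i) * real (k j) / real v \<and> Delta (A i) (A j) = mult_group lam)
      \<longleftrightarrow> uniform (Delta (A i) (A j))"
    if "CARD('a) = v" "size (A i) = k i" "size (A j) = k j" for i j
    using that unfolding uniform_def by metis
  then show ?thesis
    unfolding nondisjoint_MGPSEDF_def
    \<comment> \<open>\<open>conj_cong\<close> makes the order and size conditions available while
      the condition on differences is rewritten.\<close>
    by (intro conj_cong refl ball_cong imp_cong) auto
qed

lemma nondisjoint_GPSEDF_iff_MGPSEDF:
  "nondisjoint_GPSEDF v m k A \<longleftrightarrow> nondisjoint_MGPSEDF v m k (\<lambda>i. mset_set (A i))"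
  by (simp add: nondisjoint_GPSEDF_def nondisjoint_MGPSEDF_def)

lemma mset_set_fun_upd: "(\<lambda>i. mset_set ((A(j := B)) i)) = (\<lambda>i. mset_set (A i))(j := mset_set B)"
  by auto

text \<open>Only pairs containing \<open>j\<close> change, and by symmetry one order of each pair
  suffices. Every statement that alters a single member reduces to this.\<close>

lemma nondisjoint_MGPSEDF_upd:
  assumes "nondisjoint_MGPSEDF v m k A" and "size B = l"
    and "\<And>i. i \<in> {1..m} \<Longrightarrow> i \<noteq> j \<Longrightarrow> uniform (Delta (A i) B)"
  shows "nondisjoint_MGPSEDF v m (k(j := l)) (A(j := B))"
  using assms uniform_Delta_commute[of B] by (simp add: nondisjoint_MGPSEDF_iff)

lemma nondisjoint_GPSEDF_upd:
  assumes "nondisjoint_GPSEDF v m k A" and "card B = l"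
    and "\<And>i. i \<in> {1..m} \<Longrightarrow> i \<noteq> j \<Longrightarrow> uniform (Delta (mset_set (A i)) (mset_set B))"
  shows "nondisjoint_GPSEDF v m (k(j := l)) (A(j := B))"
  using assms unfolding nondisjoint_GPSEDF_iff_MGPSEDF mset_set_fun_upd
  by (intro nondisjoint_MGPSEDF_upd) auto

theorem theorem2p24:
  fixes A :: "nat \<Rightarrow> 'a::{group_add,finite} set"
    and k :: "nat \<Rightarrow> nat" and v m :: nat
  assumes "1 \<le> m"
    and "nondisjoint_GPSEDF v m k A"
  shows
    "(\<forall>j\<in>{1..m}. nondisjoint_GPSEDF v m (k(j := v - k j)) (A(j := UNIV - A j))) \<and>
     nondisjoint_GPSEDF v m (\<lambda>i. v - k i) (\<lambda>i. UNIV - A i) \<and>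
     (\<forall>g. nondisjoint_GPSEDF v m k (A(m := translate g (A m)))) \<and>
     (\<forall>(B :: 'a multiset) l.
        nondisjoint_MGPSEDF v m (k(m := l)) ((\<lambda>i. mset_set (A i))(m := B)) \<longrightarrow>
        nondisjoint_MGPSEDF v m (k(m := k m + l))
          ((\<lambda>i. mset_set (A i))(m := mset_set (A m) + B))) \<and>
     (\<forall>(B :: 'a set) l.
        nondisjoint_GPSEDF v m (k(m := l)) (A(m := B)) \<and> A m \<inter> B = {} \<longrightarrow>
        mset_set (A m) + mset_set B = mset_set (A m \<union> B) \<and>
        nondisjoint_GPSEDF v m (k(m := k m + l)) (A(m := A m \<union> B))) \<and>
     (\<forall>n (g :: nat \<Rightarrow> 'a).
        nondisjoint_MGPSEDF v m (k(m := n * k m))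
          ((\<lambda>i. mset_set (A i))(m := (\<Sum>i=1..n. mset_set (translate (g i) (A m))))) \<and>
        (disjoint_family_on (\<lambda>i. translate (g i) (A m)) {1..n} \<longrightarrow>
          (\<Sum>i=1..n. mset_set (translate (g i) (A m))) =
            mset_set (\<Union>i\<in>{1..n}. translate (g i) (A m)) \<and>
          nondisjoint_GPSEDF v m (k(m := n * k m))
            (A(m := (\<Union>i\<in>{1..n}. translate (g i) (A m))))))"
proof -
  let ?M = "\<lambda>i. mset_set (A i)"
  have card_A: "card (A i) = k i" if "i \<in> {1..m}" for i
    using assms(2) that by (simp add: nondisjoint_GPSEDF_def)
  have v: "v = CARD('a)"
    using assms(2) by (simp add: nondisjoint_GPSEDF_def)
  have m: "m \<in> {1..m}"
    using assms(1) by simp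
  have M: "nondisjoint_MGPSEDF v m k ?M"
    using assms(2) by (simp add: nondisjoint_GPSEDF_iff_MGPSEDF)
  have unif: "uniform (Delta (?M i) (?M j))" if "i \<in> {1..m}" "j \<in> {1..m}" "i \<noteq> j" for i j
    using M that by (simp add: nondisjoint_MGPSEDF_iff)
  \<comment> \<open>Truncated subtraction is harmless: \<open>k i\<close> is the size of a subset of
    a group of order \<open>v\<close>.\<close>
  have card_Compl: "card (UNIV - A i) = v - k i" if "i \<in> {1..m}" for i
    using card_A[OF that] v by (simp add: card_Diff_subset)
  have "nondisjoint_GPSEDF v m (k(j := v - k j)) (A(j := UNIV - A j))" if "j \<in> {1..m}" for j
    using assms(2) card_Compl[OF that] that
    by (intro nondisjoint_GPSEDF_upd uniform_Delta_Compl unif) auto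
  moreover have "nondisjoint_GPSEDF v m (\<lambda>i. v - k i) (\<lambda>i. UNIV - A i)"
    unfolding nondisjoint_GPSEDF_iff_MGPSEDF nondisjoint_MGPSEDF_iff
  proof (intro conjI ballI impI)
    fix i j assume "i \<in> {1..m}" "j \<in> {1..m}" "i \<noteq> j"
    \<comment> \<open>Here both members of a pair change, so they are complemented one after the
      other, each while it is the second argument, with a swap in between.\<close>
    then have "uniform (Delta (mset_set (UNIV - A j)) (?M i))"
      using uniform_Delta_Compl unif uniform_Delta_commute by blast
    then show "uniform (Delta (mset_set (UNIV - A i)) (mset_set (UNIV - A j)))"
      using uniform_Delta_Compl uniform_Delta_commute by blast
  qed (use card_Compl v in auto)
  moreover have "nondisjoint_GPSEDF v m k (A(m := translate g (A m)))" for g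
  proof -
    \<comment> \<open>Translation preserves size, so the update of \<open>k\<close> is the
      identity.\<close>
    have "nondisjoint_GPSEDF v m (k(m := k m)) (A(m := translate g (A m)))"
      using assms(2) card_A[OF m] m
      by (intro nondisjoint_GPSEDF_upd uniform_Delta_translate unif) (auto simp: card_translate)
    then show ?thesis
      by simp
  qed
  moreover have union: "nondisjoint_MGPSEDF v m (k(m := k m + l)) (?M(m := ?M m + B))"
    if B: "nondisjoint_MGPSEDF v m (k(m := l)) (?M(m := B))" for B l
  proof (rule nondisjoint_MGPSEDF_upd[OF M])
    \<comment> \<open>The hypothesis on the second family is read at index \<open>m\<close>, which
      lies in the index range because 1 \<le> m; this gives \<open>B\<close> the size
      \<open>l\<close>.\<close>
    have "size ((?M(m := B)) m) = (k(m := l)) m"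
      using B m unfolding nondisjoint_MGPSEDF_iff by blast
    then show "size (?M m + B) = k m + l"
      using card_A[OF m] by simp
    show "uniform (Delta (?M i) (?M m + B))" if "i \<in> {1..m}" "i \<noteq> m" for i
    proof -
      have "uniform (Delta ((?M(m := B)) i) ((?M(m := B)) m))"
        using B m that unfolding nondisjoint_MGPSEDF_iff by blast
      then show ?thesis
        using that unif[OF that(1) m that(2)] by (simp add: uniform_Delta_add)
    qed
  qed
  moreover have "mset_set (A m) + mset_set B = mset_set (A m \<union> B) \<and>
      nondisjoint_GPSEDF v m (k(m := k m + l)) (A(m := A m \<union> B))"
    if B: "nondisjoint_GPSEDF v m (k(m := l)) (A(m := B))" and disj: "A m \<inter> B = {}" for B l
  proof -
    \<comment> \<open>Disjointness turns the multiset sum into a set, so the set version is the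
      multiset version already proved.\<close>
    have eq: "mset_set (A m) + mset_set B = mset_set (A m \<union> B)"
      using disj by (simp add: mset_set_Union)
    moreover have "nondisjoint_GPSEDF v m (k(m := k m + l)) (A(m := A m \<union> B))"
      using union[of l "mset_set B"] B eq
      unfolding nondisjoint_GPSEDF_iff_MGPSEDF mset_set_fun_upd by simp
    ultimately show ?thesis ..
  qed
  \<comment> \<open>Each translate has size \<open>k m\<close> and uniform differences with the
    other members, and both facts add up over the \<open>n\<close> translates, overlapping or not.
    For \<open>n\<close> = 0 the new member is empty.\<close>
  moreover have translates: "nondisjoint_MGPSEDF v m (k(m := n * k m))
      (?M(m := (\<Sum>i=1..n. mset_set (translate (g i) (A m)))))" for n and g :: "nat \<Rightarrow> 'a"
    using m card_A[OF m]
    by (intro nondisjoint_MGPSEDF_upd[OF M] uniform_Delta_sum uniform_Delta_translate unif)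
      (auto simp: size_multiset_sum card_translate)
  moreover have "(\<Sum>i=1..n. mset_set (translate (g i) (A m))) =
        mset_set (\<Union>i\<in>{1..n}. translate (g i) (A m)) \<and>
      nondisjoint_GPSEDF v m (k(m := n * k m)) (A(m := (\<Union>i\<in>{1..n}. translate (g i) (A m))))"
    if disj: "disjoint_family_on (\<lambda>i. translate (g i) (A m)) {1..n}" for n and g :: "nat \<Rightarrow> 'a"
  proof -
    have eq: "(\<Sum>i=1..n. mset_set (translate (g i) (A m))) =
        mset_set (\<Union>i\<in>{1..n}. translate (g i) (A m))"
      using disj by (intro mset_set_UN_disjoint[symmetric]) auto
    moreover have "nondisjoint_GPSEDF v m (k(m := n * k m))
        (A(m := (\<Union>i\<in>{1..n}. translate (g i) (A m))))"
      using translates[of n g] eq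
      unfolding nondisjoint_GPSEDF_iff_MGPSEDF mset_set_fun_upd by simp
    ultimately show ?thesis ..
  qed
  ultimately show ?thesis
    by blast
qed

end
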